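(* Let $c,c'$ be well-formed GCL commands and $f,f'$ labels with $\mathsf{okf}(c,f)$ and $\mathsf{okf}(c',f')$. Let $L,R,J$ be live alignment conditions for the automata $A=\mathsf{aut}(c,f)$ and $A'=\mathsf{aut}(c',f')$, and let $\mathcal{S},\mathcal{T}$ be relations on variable stores. Suppose $an$ is a valid annotation of the alignment automaton $\prod(A,A',L,R,J)$ for the specification $\langle\mathcal{S}\rangle\langle\mathcal{T}\rangle$, and suppose that for every control point $(i,j)$ of this alignment automaton, $\widehat{an}(i,j)\subseteq L\cup R\cup J\cup[f|f']$. Then the relational judgment $c\mid c' : \langle\mathcal{S}\rangle\langle\mathcal{T}\rangle$ is derivable in the proof system RHL+.
   Context: Stores are total maps from a set of integer variables to $\mathbb{Z}$. GCL commands: $c ::= \mathsf{skip}^n \mid x :=^n e \mid c;c \mid \mathsf{if}^n\, gcs\,\mathsf{fi} \mid \mathsf{do}^n\, gcs\,\mathsf{od}$, with $gcs ::= e\to c \mid e\to c \,\square\, gcs$ (nonempty lists of guarded commands), $n\in\mathbb{Z}$ a label, $e$ an (always defined) integer or boolean expression; boolean expressions are built from primitive boolean expressions with $\wedge,\vee,\neg$, and $[\![e]\!](s)$ is the value of $e$ in store $s$. $\mathsf{enab}(gcs)$ is the disjunction of the guards of $gcs$. A command is well formed if it is well typed and every subcommand $\mathsf{if}^n\,gcs\,\mathsf{fi}$ has $\mathsf{enab}(gcs)$ true in every store. The denotation $[\![c]\!]\subseteq \mathrm{Store}\times\mathrm{Store}$ (labels ignored) is standard: identity for skip; $\{(s,s[x\mapsto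 [\![e]\!](s)])\}$ for $x:=e$; composition for $;$; for if, pairs $(s,t)$ with some $e\to d\in gcs$, $e$ true at $s$, $(s,t)\in[\![d]\!]$; for do, the reflexive-transitive closure of the if-relation of $gcs$ restricted to final stores where $\mathsf{enab}(gcs)$ is false. Labels: $\mathsf{lab}(c)$ is the label of $c$ (with $\mathsf{lab}(c;d)=\mathsf{lab}(c)$); $\mathsf{labs}(c)$ the set of all labels in $c$; $\mathsf{ok}(c)$ means all labels in $c$ are positive and pairwise distinct; $\mathsf{okf}(c,f)$ means $\mathsf{ok}(c)$ and $f\notin\mathsf{labs}(c)$; $\mathsf{sub}(n,c)$ is the subcommand of $c$ labelled $n$. Following successor: $\mathsf{fsuc}(n,\mathsf{skip}^n,f)=\mathsf{fsuc}(n,x:=^ne,f)=\mathsf{fsuc}(n,\mathsf{if}^n gcs\,\mathsf{fi},f)=\mathsf{fsuc}(n,\mathsf{do}^n gcs\,\mathsf{od},f)=f$; $\mathsf{fsuc}(n,c;d,f)=\mathsf{fsuc}(n,c,\mathsf{lab}(d))$ if $n\in\mathsf{labs}(c)$ and $\mathsf{fsuc}(n,d,f)$ otherwise; for $m\ne n$ in $\mathsf{labs}(d)$ with $e\to d$ in $gcs$: $\mathsf{fsuc}(m,\mathsf{if}^n gcs\,\mathsf{fi},f)=\mathsf{fsuc}(m,d,f)$ and $\mathsf{fsuc}(m,\mathsf{do}^n gcs\,\mathsf{od},f)=\mathsf{fsuc}(m,d,n)$. Small-step semantics on configurations $\langle c,s\rangle$: $\langle \mathsf{if}^n gcs\,\mathsf{fi},s\rangle\to\langle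 d,s\rangle$ and $\langle \mathsf{do}^n gcs\,\mathsf{od},s\rangle\to\langle d;\mathsf{do}^n gcs\,\mathsf{od},s\rangle$ if $e\to d\in gcs$ and $e$ true at $s$; $\langle\mathsf{do}^n gcs\,\mathsf{od},s\rangle\to\langle\mathsf{skip}^{-n},s\rangle$ if $\mathsf{enab}(gcs)$ false at $s$; $\langle x:=^ne,s\rangle\to\langle\mathsf{skip}^{-n},s[x\mapsto[\![e]\!](s)]\rangle$; $\langle \mathsf{skip}^n;c,s\rangle\to\langle c,s\rangle$; if $\langle c,s\rangle\to\langle d,t\rangle$ then $\langle c;b,s\rangle\to\langle d;b,t\rangle$. An automaton is $(Ctrl,Sto,init,fin,\Rightarrow)$ with $Ctrl$ finite, $init\ne fin$, ${\Rightarrow}\subseteq (Ctrl\times Sto)^2$, such that $(n,s)\Rightarrow(m,t)$ implies $n\ne fin$ and $n\ne m$; states are elements of $Ctrl\times Sto$. For $\mathsf{okf}(c,f)$, $\mathsf{aut}(c,f)=(\mathsf{labs}(c)\cup\{f\},\mathrm{Store},\mathsf{lab}(c),f,\Rightarrow)$ where $(n,s)\Rightarrow(m,t)$ iff either $\langle\mathsf{sub}(n,c),s\rangle\to\langle d,t\rangle$ with $\mathsf{lab}(d)>0$ and $m=\mathsf{lab}(d)$; or $\langle\mathsf{sub}(n,c),s\rangle\to\langle d,t\rangle$ with $\mathsf{lab}(d)<0$ and $m=\mathsf{fsuc}(n,c,f)$; or $\mathsf{sub}(n,c)=\mathsf{skip}^n$, $m=\mathsf{fsuc}(n,c,f)$,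 $t=s$. Alignment automaton: for automata $A,A'$ and $L,R,J\subseteq (Ctrl\times Ctrl')\times(Sto\times Sto')$, $\prod(A,A',L,R,J)$ has control $Ctrl\times Ctrl'$, stores $Sto\times Sto'$, initial $(init,init')$, final $(fin,fin')$, and $((n,n'),(s,s'))\Rightarrow((m,m'),(t,t'))$ iff: ($((n,n'),(s,s'))\in L$, $(n,s)\Rightarrow(m,t)$, $(n',s')=(m',t')$) or ($\in R$, $(n,s)=(m,t)$, $(n',s')\Rightarrow'(m',t')$) or ($\in J$, $(n,s)\Rightarrow(m,t)$, $(n',s')\Rightarrow'(m',t')$). $(L,R,J)$ is live if every state in $L$ has an $A$-successor on the left, every state in $R$ an $A'$-successor on the right, every state in $J$ both. $[n|n']$ is the set of states whose control is $(n,n')$. Annotation of an automaton for spec $\{P\}\{Q\}$: a map $an$ from control points to sets of stores with $an(init)=P$, $an(fin)=Q$; it is valid if for all control points $n,m$, whenever $s\in an(n)$ and $(n,s)\Rightarrow(m,t)$ then $t\in an(m)$. For an alignment automaton, an annotation for $\langle\mathcal{S}\rangle\langle\mathcal{T}\rangle$ is one for the unary spec $\{\mathcal{S}\}\{\mathcal{T}\}$ on its pair-stores. Lifting: $\widehat{an}(i,j)=\{((k,k'),(s,s')) : (s,s')\in an(i,j)\}$. Relational notation: predicates are sets of stores, relations sets of pairs of stores; a boolean expression $e$ stands for $\{s:[\![e]\!](s)=\mathrm{true}\}$; $P^{\mathrm{L}}=\{(s,s'):s\in P\}$, $P^{\mathrm{R}}=\{(s,s'):s'\in P\}$; $(e^{\mathrm{L}}=e'^{\mathrm{R}})=\{(s,s'):[\![e]\!](s)=[\![e']\!](s')\}$.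 Substitution: $s\in P[x:=e]$ iff $s[x\mapsto[\![e]\!](s)]\in P$; $(s,s')\in\mathcal{R}[x|x':=e|e']$ iff $(s[x\mapsto[\![e]\!](s)],s'[x'\mapsto[\![e']\!](s')])\in\mathcal{R}$, and $\mathcal{R}[x|\,:=e|\,]$, $\mathcal{R}[\,|x:=\,|e]$ substitute on one side. $\mathrm{indep}(x|x',\mathcal{R})$ means membership of $(s,s')$ in $\mathcal{R}$ is unchanged by changing $s(x)$ and $s'(x')$ arbitrarily. $\mathsf{ghost}(x,c)$ means $x$ occurs in $c$ only in assignments to $x$; $\mathsf{erase}(x,c)$ replaces each assignment to $x$ in $c$ by skip. Valid judgment $\models c\mid c':\langle\mathcal{R}\rangle\langle\mathcal{S}\rangle$: for all $(s,t)\in[\![c]\!]$, $(s',t')\in[\![c']\!]$, $(s,s')\in\mathcal{R}$ implies $(t,t')\in\mathcal{S}$. Command equivalence $c\cong d$: $\mathrm{Hyp}\vdash \mathcal{K}(c)=\mathcal{K}(d)$ in Kleene algebra with tests (KAT), where $\mathcal{K}$ translates commands to KAT expressions over atoms (primitive boolean expressions as tests, assignments as actions): $\mathcal{K}(b)=\underline{b}$, $\mathcal{K}(e\wedge e')=\mathcal{K}(e);\mathcal{K}(e')$, $\mathcal{K}(e\vee e')=\mathcal{K}(e)+\mathcal{K}(e')$, $\mathcal{K}(\neg e)=\neg\mathcal{K}(e)$, $\mathcal{K}(x:=e)=\underline{x:=e}$, $\mathcal{K}(\mathsf{skip})=1$, $\mathcal{K}(c;d)=\mathcal{K}(c);\mathcal{K}(d)$,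 $\mathcal{K}(gcs)=\sum_{e\to c\in gcs}\mathcal{K}(e);\mathcal{K}(c)$, $\mathcal{K}(\mathsf{if}\,gcs\,\mathsf{fi})=\mathcal{K}(gcs)$, $\mathcal{K}(\mathsf{do}\,gcs\,\mathsf{od})=\mathcal{K}(gcs)^*;\neg\mathcal{K}(\mathsf{enab}(gcs))$; and $\mathrm{Hyp}$ consists of $\mathcal{K}(e)=0$ for every boolean $e$ false in all stores, and $\mathcal{K}(e_0);\underline{x:=e};\neg\mathcal{K}(e_1)=0$ whenever $e_0\Rightarrow e_1[x:=e]$ is valid; $\vdash$ is derivability from the KAT axioms (Boolean algebra on tests, idempotent semiring, $1+xx^*=x^*$, $1+x^*x=x^*$, $y+xz\le z\Rightarrow x^*y\le z$, $y+zx\le z\Rightarrow yx^*\le z$, with $x\le y$ iff $x+y=y$) plus the hypotheses. RHL+ rules (entailments $\Rightarrow$ are set inclusions): rRewrite: from $c\mid c':\langle\mathcal{R}\rangle\langle\mathcal{S}\rangle$, $c\cong d$, $c'\cong d'$ infer $d\mid d':\langle\mathcal{R}\rangle\langle\mathcal{S}\rangle$. rGhost: from $c\mid c':\langle\mathcal{R}\rangle\langle\mathcal{S}\rangle$, $\mathsf{ghost}(x,c)$, $\mathsf{ghost}(x',c')$, $\mathrm{indep}(x|x',\mathcal{R})$, $\mathrm{indep}(x|x',\mathcal{S})$ infer $\mathsf{erase}(x,c)\mid\mathsf{erase}(x',c'):\langle\mathcal{R}\rangle\langle\mathcal{S}\rangle$. dIf: from $c\mid c':\langle\mathcal{R}\wedge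 e^{\mathrm{L}}\wedge e'^{\mathrm{R}}\rangle\langle\mathcal{S}\rangle$ for all $e\to c\in gcs$, $e'\to c'\in gcs'$ infer $\mathsf{if}\,gcs\,\mathsf{fi}\mid\mathsf{if}\,gcs'\,\mathsf{fi}:\langle\mathcal{R}\rangle\langle\mathcal{S}\rangle$. dAsgn: $x:=e\mid x':=e':\langle\mathcal{R}[x|x':=e|e']\rangle\langle\mathcal{R}\rangle$. AsgnSkip: $x:=e\mid\mathsf{skip}:\langle\mathcal{R}[x|\,:=e|\,]\rangle\langle\mathcal{R}\rangle$. SkipAsgn: $\mathsf{skip}\mid x:=e:\langle\mathcal{R}[\,|x:=\,|e]\rangle\langle\mathcal{R}\rangle$. dSkip: $\mathsf{skip}\mid\mathsf{skip}:\langle\mathcal{R}\rangle\langle\mathcal{R}\rangle$. dSeq: from $c\mid c':\langle\mathcal{R}\rangle\langle\mathcal{S}\rangle$ and $d\mid d':\langle\mathcal{S}\rangle\langle\mathcal{T}\rangle$ infer $c;d\mid c';d':\langle\mathcal{R}\rangle\langle\mathcal{T}\rangle$. dDo: given relations $\mathcal{Q},\Lambda,\mathcal{P}$, from $c\mid\mathsf{skip}:\langle\mathcal{Q}\wedge e^{\mathrm{L}}\wedge\Lambda\rangle\langle\mathcal{Q}\rangle$ for all $e\to c\in gcs$, $\mathsf{skip}\mid c':\langle\mathcal{Q}\wedge e'^{\mathrm{R}}\wedge\mathcal{P}\rangle\langle\mathcal{Q}\rangle$ for all $e'\to c'\in gcs'$, $c\mid c':\langle\mathcal{Q}\wedge e^{\mathrm{L}}\wedge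 e'^{\mathrm{R}}\wedge\neg\Lambda\wedge\neg\mathcal{P}\rangle\langle\mathcal{Q}\rangle$ for all such pairs, and $\mathcal{Q}\Rightarrow(\mathsf{enab}(gcs)^{\mathrm{L}}=\mathsf{enab}(gcs')^{\mathrm{R}})\vee(\Lambda\wedge\mathsf{enab}(gcs)^{\mathrm{L}})\vee(\mathcal{P}\wedge\mathsf{enab}(gcs')^{\mathrm{R}})$, infer $\mathsf{do}\,gcs\,\mathsf{od}\mid\mathsf{do}\,gcs'\,\mathsf{od}:\langle\mathcal{Q}\rangle\langle\mathcal{Q}\wedge\neg\mathsf{enab}(gcs)^{\mathrm{L}}\wedge\neg\mathsf{enab}(gcs')^{\mathrm{R}}\rangle$. rConseq: from $\mathcal{P}\Rightarrow\mathcal{R}$, $c\mid d:\langle\mathcal{R}\rangle\langle\mathcal{S}\rangle$, $\mathcal{S}\Rightarrow\mathcal{Q}$ infer $c\mid d:\langle\mathcal{P}\rangle\langle\mathcal{Q}\rangle$. rDisj: from $c\mid d:\langle\mathcal{Q}\rangle\langle\mathcal{S}\rangle$ and $c\mid d:\langle\mathcal{R}\rangle\langle\mathcal{S}\rangle$ infer $c\mid d:\langle\mathcal{Q}\vee\mathcal{R}\rangle\langle\mathcal{S}\rangle$. rFalse: $c\mid d:\langle\mathrm{false}\rangle\langle\mathcal{R}\rangle$. *)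

theory Defs
  imports Main
begin

section \<open>Expressions and commands\<close>

type_synonym 'v store = "'v \<Rightarrow> int"

text \<open>
  The syntax of integer expressions and of primitive boolean expressions is left open: they are
  elements of arbitrary types \<open>'i\<close> and \<open>'p\<close>, given together with their (total) values and the sets
  of variables occurring in them. Everything below is relative to such a language.
\<close>

record ('v, 'i, 'p) lang =
  ival :: "'i \<Rightarrow> 'v store \<Rightarrow> int"
  pval :: "'p \<Rightarrow> 'v store \<Rightarrow> bool"
  ivars :: "'i \<Rightarrow> 'v set"
  pvars :: "'p \<Rightarrow> 'v set"

definition expr_lang :: "('v, 'i, 'p) lang \<Rightarrow> bool" where
  "expr_lang E \<longleftrightarrow>
     (\<forall>e s t. (\<forall>x\<in>ivars E e. s x = t x) \<longrightarrow> ival E e s = ival E e t) \<and>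
     (\<forall>b s t. (\<forall>x\<in>pvars E b. s x = t x) \<longrightarrow> pval E b s = pval E b t)"

datatype 'p bexp =
    BPrim 'p
  | BAnd "'p bexp" "'p bexp"
  | BOr "'p bexp" "'p bexp"
  | BNot "'p bexp"

primrec bval :: "('v, 'i, 'p) lang \<Rightarrow> 'p bexp \<Rightarrow> 'v store \<Rightarrow> bool" where
  "bval E (BPrim b) s = pval E b s"
| "bval E (BAnd e e') s = (bval E e s \<and> bval E e' s)"
| "bval E (BOr e e') s = (bval E e s \<or> bval E e' s)"
| "bval E (BNot e) s = (\<not> bval E e s)"

primrec bvars :: "('v, 'i, 'p) lang \<Rightarrow> 'p bexp \<Rightarrow> 'v set" where
  "bvars E (BPrim b) = pvars E b"
| "bvars E (BAnd e e') = bvars E e \<union> bvars E e'"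
| "bvars E (BOr e e') = bvars E e \<union> bvars E e'"
| "bvars E (BNot e) = bvars E e"

text \<open>
  Assignments take an integer expression and guards are boolean, so every term of type \<open>com\<close> is
  well typed. The type \<open>gcs\<close> consists of the nonempty lists of guarded commands.
\<close>

datatype ('v, 'i, 'p) com =
    Skip int
  | Asgn int 'v 'i
  | Seq "('v, 'i, 'p) com" "('v, 'i, 'p) com"
  | If int "('v, 'i, 'p) gcs"
  | Do int "('v, 'i, 'p) gcs"
and ('v, 'i, 'p) gcs =
    GOne "'p bexp" "('v, 'i, 'p) com"
  | GCons "'p bexp" "('v, 'i, 'p) com" "('v, 'i, 'p) gcs"

primrec guarded :: "('v, 'i, 'p) gcs \<Rightarrow> ('p bexp \<times> ('v, 'i, 'p) com) set" where
  "guarded (GOne e c) = {(e, c)}"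
| "guarded (GCons e c g) = insert (e, c) (guarded g)"

primrec enab :: "('v, 'i, 'p) gcs \<Rightarrow> 'p bexp" where
  "enab (GOne e c) = e"
| "enab (GCons e c g) = BOr e (enab g)"

primrec wf_com :: "('v, 'i, 'p) lang \<Rightarrow> ('v, 'i, 'p) com \<Rightarrow> bool"
  and wf_gcs :: "('v, 'i, 'p) lang \<Rightarrow> ('v, 'i, 'p) gcs \<Rightarrow> bool" where
  "wf_com E (Skip n) = True"
| "wf_com E (Asgn n x e) = True"
| "wf_com E (Seq c d) = (wf_com E c \<and> wf_com E d)"
| "wf_com E (If n g) = (wf_gcs E g \<and> (\<forall>s. bval E (enab g) s))"
| "wf_com E (Do n g) = wf_gcs E g"
| "wf_gcs E (GOne e c) = wf_com E c"
| "wf_gcs E (GCons e c g) = (wf_com E c \<and> wf_gcs E g)"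


section \<open>Labels\<close>

primrec lab :: "('v, 'i, 'p) com \<Rightarrow> int" where
  "lab (Skip n) = n"
| "lab (Asgn n x e) = n"
| "lab (Seq c d) = lab c"
| "lab (If n g) = n"
| "lab (Do n g) = n"

text \<open>The labels are collected in a list, so that repeated labels can be detected.\<close>

primrec lablist :: "('v, 'i, 'p) com \<Rightarrow> int list"
  and lablist_gcs :: "('v, 'i, 'p) gcs \<Rightarrow> int list" where
  "lablist (Skip n) = [n]"
| "lablist (Asgn n x e) = [n]"
| "lablist (Seq c d) = lablist c @ lablist d"
| "lablist (If n g) = n # lablist_gcs g"
| "lablist (Do n g) = n # lablist_gcs g"
| "lablist_gcs (GOne e c) = lablist c"
| "lablist_gcs (GCons e c g) = lablist c @ lablist_gcs g"

definition labs :: "('v, 'i, 'p) com \<Rightarrow> int set" where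
  "labs c = set (lablist c)"

definition ok :: "('v, 'i, 'p) com \<Rightarrow> bool" where
  "ok c \<longleftrightarrow> (\<forall>n\<in>labs c. n > 0) \<and> distinct (lablist c)"

definition okf :: "('v, 'i, 'p) com \<Rightarrow> int \<Rightarrow> bool" where
  "okf c f \<longleftrightarrow> ok c \<and> f \<notin> labs c"

text \<open>
  The subcommand labelled \<open>n\<close>, if there is one. A sequence carries the label of its first
  component, but the subcommand with that label is the component, never the sequence.
\<close>

primrec sub :: "int \<Rightarrow> ('v, 'i, 'p) com \<Rightarrow> ('v, 'i, 'p) com option"
  and sub_gcs :: "int \<Rightarrow> ('v, 'i, 'p) gcs \<Rightarrow> ('v, 'i, 'p) com option" where
  "sub n (Skip m) = (if n = m then Some (Skip m) else None)"
| "sub n (Asgn m x e) = (if n = m then Some (Asgn m x e) else None)"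
| "sub n (Seq c d) = (if n \<in> labs c then sub n c else sub n d)"
| "sub n (If m g) = (if n = m then Some (If m g) else sub_gcs n g)"
| "sub n (Do m g) = (if n = m then Some (Do m g) else sub_gcs n g)"
| "sub_gcs n (GOne e c) = sub n c"
| "sub_gcs n (GCons e c g) = (if n \<in> labs c then sub n c else sub_gcs n g)"

text \<open>
  Following successor \<open>fsuc n c f\<close>, meaningful only for \<open>n \<in> labs c\<close>. For guarded commands the
  recursion descends into the body containing \<open>n\<close>.
\<close>

primrec fsuc :: "int \<Rightarrow> ('v, 'i, 'p) com \<Rightarrow> int \<Rightarrow> int"
  and fsuc_gcs :: "int \<Rightarrow> ('v, 'i, 'p) gcs \<Rightarrow> int \<Rightarrow> int" where
  "fsuc n (Skip m) f = f"
| "fsuc n (Asgn m x e) f = f"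
| "fsuc n (Seq c d) f = (if n \<in> labs c then fsuc n c (lab d) else fsuc n d f)"
| "fsuc n (If m g) f = (if n = m then f else fsuc_gcs n g f)"
| "fsuc n (Do m g) f = (if n = m then f else fsuc_gcs n g m)"
| "fsuc_gcs n (GOne e c) f = fsuc n c f"
| "fsuc_gcs n (GCons e c g) f = (if n \<in> labs c then fsuc n c f else fsuc_gcs n g f)"


section \<open>Small-step semantics and automata\<close>

inductive step :: "('v, 'i, 'p) lang \<Rightarrow> ('v, 'i, 'p) com \<times> 'v store \<Rightarrow> ('v, 'i, 'p) com \<times> 'v store \<Rightarrow> bool"
  for E where
  If: "\<lbrakk>(e, d) \<in> guarded g; bval E e s\<rbrakk> \<Longrightarrow> step E (If n g, s) (d, s)"
| DoIter: "\<lbrakk>(e, d) \<in> guarded g; bval E e s\<rbrakk> \<Longrightarrow> step E (Do n g, s) (Seq d (Do n g), s)"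
| DoExit: "\<not> bval E (enab g) s \<Longrightarrow> step E (Do n g, s) (Skip (- n), s)"
| Asgn: "step E (Asgn n x e, s) (Skip (- n), s(x := ival E e s))"
| SkipSeq: "step E (Seq (Skip n) c, s) (c, s)"
| Seq: "step E (c, s) (d, t) \<Longrightarrow> step E (Seq c b, s) (Seq d b, t)"

text \<open>The set of stores of an automaton is the type \<open>'s\<close>.\<close>

record ('n, 's) automaton =
  ctrl :: "'n set"
  init :: "'n"
  fin :: "'n"
  trans :: "'n \<times> 's \<Rightarrow> 'n \<times> 's \<Rightarrow> bool"

definition is_automaton :: "('n, 's) automaton \<Rightarrow> bool" where
  "is_automaton A \<longleftrightarrow>
     finite (ctrl A) \<and> init A \<in> ctrl A \<and> fin A \<in> ctrl A \<and> init A \<noteq> fin A \<and>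
     (\<forall>n s m t. trans A (n, s) (m, t) \<longrightarrow>
        n \<in> ctrl A \<and> m \<in> ctrl A \<and> n \<noteq> fin A \<and> n \<noteq> m)"

definition aut_trans ::
  "('v, 'i, 'p) lang \<Rightarrow> ('v, 'i, 'p) com \<Rightarrow> int \<Rightarrow> int \<times> 'v store \<Rightarrow> int \<times> 'v store \<Rightarrow> bool" where
  "aut_trans E c f = (\<lambda>(n, s) (m, t). \<exists>b. sub n c = Some b \<and>
     ((\<exists>d. step E (b, s) (d, t) \<and> lab d > 0 \<and> m = lab d) \<or>
      (\<exists>d. step E (b, s) (d, t) \<and> lab d < 0 \<and> m = fsuc n c f) \<or>
      (b = Skip n \<and> m = fsuc n c f \<and> t = s)))"

definition aut :: "('v, 'i, 'p) lang \<Rightarrow> ('v, 'i, 'p) com \<Rightarrow> int \<Rightarrow> (int, 'v store) automaton" where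
  "aut E c f = \<lparr>ctrl = labs c \<union> {f}, init = lab c, fin = f, trans = aut_trans E c f\<rparr>"

lemma lab_in_labs: "lab c \<in> labs c"
  by (induction c rule: com.induct[where ?P2.0 = "\<lambda>_. True"]) (auto simp: labs_def)

lemma body_labs: "(e, c) \<in> guarded g \<Longrightarrow> labs c \<subseteq> set (lablist_gcs g)"
  by (induction g rule: gcs.induct[where ?P1.0 = "\<lambda>_. True"]) (auto simp: labs_def)

lemma sub_Some:
  fixes c :: "('v, 'i, 'p) com" and g :: "('v, 'i, 'p) gcs"
  shows "sub n c = Some b \<Longrightarrow> distinct (lablist c) \<Longrightarrow>
     lab b = n \<and> labs b \<subseteq> labs c \<and> distinct (lablist b) \<and> (\<forall>c d. b \<noteq> Seq c d)"
    and "sub_gcs n g = Some b \<Longrightarrow> distinct (lablist_gcs g) \<Longrightarrow>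
     lab b = n \<and> labs b \<subseteq> set (lablist_gcs g) \<and> distinct (lablist b) \<and> (\<forall>c d. b \<noteq> Seq c d)"
  by (induction c and g) (auto simp: labs_def split: if_splits)

lemma sub_labs:
  fixes c :: "('v, 'i, 'p) com" and g :: "('v, 'i, 'p) gcs"
  shows "n \<in> labs c \<longleftrightarrow> sub n c \<noteq> None"
    and "n \<in> set (lablist_gcs g) \<longleftrightarrow> sub_gcs n g \<noteq> None"
  by (induction c and g) (auto simp: labs_def split: if_splits)

lemma fsuc_in:
  fixes c :: "('v, 'i, 'p) com" and g :: "('v, 'i, 'p) gcs"
  shows "n \<in> labs c \<Longrightarrow> distinct (lablist c) \<Longrightarrow> f \<notin> labs c \<Longrightarrow>
      fsuc n c f \<in> labs c \<union> {f} \<and> fsuc n c f \<noteq> n"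
    and "n \<in> set (lablist_gcs g) \<Longrightarrow> distinct (lablist_gcs g) \<Longrightarrow> f \<notin> set (lablist_gcs g) \<Longrightarrow>
      fsuc_gcs n g f \<in> set (lablist_gcs g) \<union> {f} \<and> fsuc_gcs n g f \<noteq> n"
proof (induction c and g arbitrary: f and f)
  case (Seq c d)
  have *: "lab d \<in> set (lablist d)" using lab_in_labs[of d] by (simp add: labs_def)
  show ?case
  proof (cases "n \<in> labs c")
    case True
    have "lab d \<notin> labs c" using * Seq.prems by (auto simp: labs_def)
    then show ?thesis using Seq.IH(1)[of "lab d"] Seq.prems True * by (auto simp: labs_def)
  next
    case False
    then show ?thesis using Seq.IH(2)[of f] Seq.prems by (auto simp: labs_def)
  qed
next
  case (If m g) then show ?case using If.IH[of f] by (auto simp: labs_def)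
next
  case (Do m g) then show ?case using Do.IH[of m] by (auto simp: labs_def)
next
  case (GOne e c) then show ?case using GOne.IH[of f] by (auto simp: labs_def)
next
  case (GCons e c g)
  then show ?case using GCons.IH(1)[of f] GCons.IH(2)[of f] by (auto simp: labs_def)
qed (auto simp: labs_def)

lemma step_lab: "step E (b, s) (d, t) \<Longrightarrow> distinct (lablist b) \<Longrightarrow> (\<forall>c d. b \<noteq> Seq c d) \<Longrightarrow>
   \<forall>n\<in>labs b. n > 0 \<Longrightarrow> lab d > 0 \<Longrightarrow> lab d \<in> labs b \<and> lab d \<noteq> lab b"
proof (erule step.cases, goal_cases)
  case (1 e d' g s' n)
  then have "lab d \<in> set (lablist_gcs g)" using body_labs[of e d g] lab_in_labs[of d] by auto
  then show ?case using 1 by (auto simp: labs_def)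
next
  case (2 e d' g s' n)
  then have "lab d \<in> set (lablist_gcs g)" using body_labs[of e d' g] lab_in_labs[of d'] by auto
  then show ?case using 2 by (auto simp: labs_def)
qed (auto simp: labs_def)

lemma aut_is_automaton:
  assumes "okf c f" shows "is_automaton (aut E c f)"
proof -
  have o: "distinct (lablist c)" "f \<notin> labs c" "\<forall>n\<in>labs c. n > 0"
    using assms by (auto simp: okf_def ok_def)
  { fix n s m t assume "aut_trans E c f (n, s) (m, t)"
    then obtain b where b: "sub n c = Some b" and
      d: "(\<exists>d. step E (b, s) (d, t) \<and> lab d > 0 \<and> m = lab d) \<or> m = fsuc n c f"
      by (auto simp: aut_trans_def)
    have n: "n \<in> labs c" using b by (simp add: sub_labs)
    have "m \<in> labs c \<union> {f} \<and> m \<noteq> n"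
      using d
    proof
      assume "\<exists>d. step E (b, s) (d, t) \<and> lab d > 0 \<and> m = lab d"
      then obtain d where st: "step E (b, s) (d, t)" "lab d > 0" and m: "m = lab d" by auto
      have sb: "lab b = n" "labs b \<subseteq> labs c" "distinct (lablist b)" "\<forall>c d. b \<noteq> Seq c d"
        using sub_Some(1)[OF b o(1)] by auto
      have "\<forall>n\<in>labs b. n > 0" using sb(2) o(3) by auto
      from step_lab[OF st(1) sb(3,4) this st(2)] show ?thesis using m sb(1,2) by auto
    next
      assume "m = fsuc n c f"
      then show ?thesis using fsuc_in(1)[OF n o(1,2)] by simp
    qed
    moreover have "n \<noteq> f" using n o(2) by auto
    ultimately have "n \<in> labs c \<and> n \<noteq> f \<and> m \<in> labs c \<union> {f} \<and> m \<noteq> n" using n by simp }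
  note tr = this
  have "lab c \<noteq> f" using lab_in_labs[of c] o(2) by metis
  moreover have "finite (labs c)" by (simp add: labs_def)
  ultimately show ?thesis
    unfolding is_automaton_def aut_def using lab_in_labs[of c] tr by simp metis
qed


section \<open>Alignment automata and annotations\<close>

type_synonym ('n, 'n', 's, 's') conds = "(('n \<times> 'n') \<times> ('s \<times> 's')) set"

definition align_trans ::
  "('n, 's) automaton \<Rightarrow> ('n', 's') automaton \<Rightarrow>
   ('n, 'n', 's, 's') conds \<Rightarrow> ('n, 'n', 's, 's') conds \<Rightarrow> ('n, 'n', 's, 's') conds \<Rightarrow>
   ('n \<times> 'n') \<times> ('s \<times> 's') \<Rightarrow> ('n \<times> 'n') \<times> ('s \<times> 's') \<Rightarrow> bool" where
  "align_trans A A' L R J = (\<lambda>((n, n'), (s, s')) ((m, m'), (t, t')).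
     (((n, n'), (s, s')) \<in> L \<and> trans A (n, s) (m, t) \<and> (n', s') = (m', t')) \<or>
     (((n, n'), (s, s')) \<in> R \<and> (n, s) = (m, t) \<and> trans A' (n', s') (m', t')) \<or>
     (((n, n'), (s, s')) \<in> J \<and> trans A (n, s) (m, t) \<and> trans A' (n', s') (m', t')))"

definition align ::
  "('n, 's) automaton \<Rightarrow> ('n', 's') automaton \<Rightarrow>
   ('n, 'n', 's, 's') conds \<Rightarrow> ('n, 'n', 's, 's') conds \<Rightarrow> ('n, 'n', 's, 's') conds \<Rightarrow>
   ('n \<times> 'n', 's \<times> 's') automaton" where
  "align A A' L R J =
     \<lparr>ctrl = ctrl A \<times> ctrl A', init = (init A, init A'), fin = (fin A, fin A'),
      trans = align_trans A A' L R J\<rparr>"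

definition live ::
  "('n, 's) automaton \<Rightarrow> ('n', 's') automaton \<Rightarrow>
   ('n, 'n', 's, 's') conds \<Rightarrow> ('n, 'n', 's, 's') conds \<Rightarrow> ('n, 'n', 's, 's') conds \<Rightarrow> bool" where
  "live A A' L R J \<longleftrightarrow>
     (\<forall>n n' s s'. ((n, n'), (s, s')) \<in> L \<longrightarrow> (\<exists>m t. trans A (n, s) (m, t))) \<and>
     (\<forall>n n' s s'. ((n, n'), (s, s')) \<in> R \<longrightarrow> (\<exists>m' t'. trans A' (n', s') (m', t'))) \<and>
     (\<forall>n n' s s'. ((n, n'), (s, s')) \<in> J \<longrightarrow>
        (\<exists>m t. trans A (n, s) (m, t)) \<and> (\<exists>m' t'. trans A' (n', s') (m', t')))"

definition at_ctrl :: "'n \<Rightarrow> 'n' \<Rightarrow> ('n, 'n', 's, 's') conds" where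
  "at_ctrl n n' = {((k, k'), (s, s')). k = n \<and> k' = n'}"

definition annotation :: "('n, 's) automaton \<Rightarrow> 's set \<Rightarrow> 's set \<Rightarrow> ('n \<Rightarrow> 's set) \<Rightarrow> bool" where
  "annotation A P Q an \<longleftrightarrow> an (init A) = P \<and> an (fin A) = Q"

definition valid_annotation :: "('n, 's) automaton \<Rightarrow> ('n \<Rightarrow> 's set) \<Rightarrow> bool" where
  "valid_annotation A an \<longleftrightarrow>
     (\<forall>n\<in>ctrl A. \<forall>m\<in>ctrl A. \<forall>s t. s \<in> an n \<longrightarrow> trans A (n, s) (m, t) \<longrightarrow> t \<in> an m)"

text \<open>
  The lifting of \<open>an k\<close> to states puts no constraint on the control component of a state, other
  than that it is a control point of the automaton.
\<close>

definition lift_annotation :: "('n, 's) automaton \<Rightarrow> ('n \<Rightarrow> 's set) \<Rightarrow> 'n \<Rightarrow> ('n \<times> 's) set" where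
  "lift_annotation A an i = {(k, s). k \<in> ctrl A \<and> s \<in> an i}"


section \<open>Command equivalence\<close>

text \<open>
  KAT expressions are two-sorted: tests embed into expressions, and negation applies to tests only.
  The constants \<open>0\<close> and \<open>1\<close> of the Kleene algebra are the embedded ones of the test algebra.
\<close>

datatype 'p ktest =
    TPrim 'p
  | TZero
  | TOne
  | TPlus "'p ktest" "'p ktest"
  | TSeq "'p ktest" "'p ktest"
  | TNeg "'p ktest"

datatype ('v, 'i, 'p) kexp =
    KTest "'p ktest"
  | KAct 'v 'i
  | KPlus "('v, 'i, 'p) kexp" "('v, 'i, 'p) kexp"
  | KSeq "('v, 'i, 'p) kexp" "('v, 'i, 'p) kexp"
  | KStar "('v, 'i, 'p) kexp"

abbreviation KZero :: "('v, 'i, 'p) kexp" where "KZero \<equiv> KTest TZero"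
abbreviation KOne :: "('v, 'i, 'p) kexp" where "KOne \<equiv> KTest TOne"

primrec ktest_of :: "'p bexp \<Rightarrow> 'p ktest" where
  "ktest_of (BPrim b) = TPrim b"
| "ktest_of (BAnd e e') = TSeq (ktest_of e) (ktest_of e')"
| "ktest_of (BOr e e') = TPlus (ktest_of e) (ktest_of e')"
| "ktest_of (BNot e) = TNeg (ktest_of e)"

primrec kexp_of :: "('v, 'i, 'p) com \<Rightarrow> ('v, 'i, 'p) kexp"
  and kexp_of_gcs :: "('v, 'i, 'p) gcs \<Rightarrow> ('v, 'i, 'p) kexp" where
  "kexp_of (Skip n) = KOne"
| "kexp_of (Asgn n x e) = KAct x e"
| "kexp_of (Seq c d) = KSeq (kexp_of c) (kexp_of d)"
| "kexp_of (If n g) = kexp_of_gcs g"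
| "kexp_of (Do n g) = KSeq (KStar (kexp_of_gcs g)) (KTest (TNeg (ktest_of (enab g))))"
| "kexp_of_gcs (GOne e c) = KSeq (KTest (ktest_of e)) (kexp_of c)"
| "kexp_of_gcs (GCons e c g) = KPlus (KSeq (KTest (ktest_of e)) (kexp_of c)) (kexp_of_gcs g)"

text \<open>
  \<open>kat_eq E t u\<close>: the equation \<open>t = u\<close> is derivable from the axioms of KAT and the hypotheses Hyp
  determined by the semantics of expressions, namely \<open>HypTest\<close> and \<open>HypAsgn\<close>. An inequation
  \<open>t \<le> u\<close> is the equation \<open>t + u = u\<close>. The rules \<open>Test*\<close> together with the semiring laws make the
  tests a Boolean algebra.
\<close>

inductive kat_eq :: "('v, 'i, 'p) lang \<Rightarrow> ('v, 'i, 'p) kexp \<Rightarrow> ('v, 'i, 'p) kexp \<Rightarrow> bool"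
  for E where
  Refl: "kat_eq E t t"
| Sym: "kat_eq E t u \<Longrightarrow> kat_eq E u t"
| Trans: "\<lbrakk>kat_eq E t u; kat_eq E u v\<rbrakk> \<Longrightarrow> kat_eq E t v"
| PlusCong: "\<lbrakk>kat_eq E t t'; kat_eq E u u'\<rbrakk> \<Longrightarrow> kat_eq E (KPlus t u) (KPlus t' u')"
| SeqCong: "\<lbrakk>kat_eq E t t'; kat_eq E u u'\<rbrakk> \<Longrightarrow> kat_eq E (KSeq t u) (KSeq t' u')"
| StarCong: "kat_eq E t t' \<Longrightarrow> kat_eq E (KStar t) (KStar t')"
| NegCong: "kat_eq E (KTest p) (KTest q) \<Longrightarrow> kat_eq E (KTest (TNeg p)) (KTest (TNeg q))"
| EmbPlus: "kat_eq E (KTest (TPlus p q)) (KPlus (KTest p) (KTest q))"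
| EmbSeq: "kat_eq E (KTest (TSeq p q)) (KSeq (KTest p) (KTest q))"
| PlusAssoc: "kat_eq E (KPlus (KPlus t u) v) (KPlus t (KPlus u v))"
| PlusComm: "kat_eq E (KPlus t u) (KPlus u t)"
| PlusIdem: "kat_eq E (KPlus t t) t"
| PlusZero: "kat_eq E (KPlus t KZero) t"
| SeqAssoc: "kat_eq E (KSeq (KSeq t u) v) (KSeq t (KSeq u v))"
| SeqOneL: "kat_eq E (KSeq KOne t) t"
| SeqOneR: "kat_eq E (KSeq t KOne) t"
| SeqZeroL: "kat_eq E (KSeq KZero t) KZero"
| SeqZeroR: "kat_eq E (KSeq t KZero) KZero"
| DistL: "kat_eq E (KSeq t (KPlus u v)) (KPlus (KSeq t u) (KSeq t v))"
| DistR: "kat_eq E (KSeq (KPlus t u) v) (KPlus (KSeq t v) (KSeq u v))"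
| StarUnfoldL: "kat_eq E (KPlus KOne (KSeq t (KStar t))) (KStar t)"
| StarUnfoldR: "kat_eq E (KPlus KOne (KSeq (KStar t) t)) (KStar t)"
| StarInductL: "kat_eq E (KPlus (KPlus u (KSeq t v)) v) v \<Longrightarrow>
    kat_eq E (KPlus (KSeq (KStar t) u) v) v"
| StarInductR: "kat_eq E (KPlus (KPlus u (KSeq v t)) v) v \<Longrightarrow>
    kat_eq E (KPlus (KSeq u (KStar t)) v) v"
| TestComm: "kat_eq E (KTest (TSeq p q)) (KTest (TSeq q p))"
| TestDist: "kat_eq E (KTest (TPlus p (TSeq q r))) (KTest (TSeq (TPlus p q) (TPlus p r)))"
| TestExcl: "kat_eq E (KTest (TPlus p (TNeg p))) KOne"
| TestContr: "kat_eq E (KTest (TSeq p (TNeg p))) KZero"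
| HypTest: "(\<And>s. \<not> bval E e s) \<Longrightarrow> kat_eq E (KTest (ktest_of e)) KZero"
| HypAsgn: "(\<And>s. bval E e0 s \<Longrightarrow> bval E e1 (s(x := ival E e s))) \<Longrightarrow>
    kat_eq E (KSeq (KSeq (KTest (ktest_of e0)) (KAct x e)) (KTest (TNeg (ktest_of e1)))) KZero"

definition com_equiv :: "('v, 'i, 'p) lang \<Rightarrow> ('v, 'i, 'p) com \<Rightarrow> ('v, 'i, 'p) com \<Rightarrow> bool" where
  "com_equiv E c d \<longleftrightarrow> kat_eq E (kexp_of c) (kexp_of d)"


section \<open>The proof system RHL+\<close>

type_synonym 'v rel_on_stores = "('v store \<times> 'v store) set"

definition on_left :: "('v, 'i, 'p) lang \<Rightarrow> 'p bexp \<Rightarrow> 'v rel_on_stores" where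
  "on_left E e = {(s, s'). bval E e s}"

definition on_right :: "('v, 'i, 'p) lang \<Rightarrow> 'p bexp \<Rightarrow> 'v rel_on_stores" where
  "on_right E e = {(s, s'). bval E e s'}"

definition agree :: "('v, 'i, 'p) lang \<Rightarrow> 'p bexp \<Rightarrow> 'p bexp \<Rightarrow> 'v rel_on_stores" where
  "agree E e e' = {(s, s'). bval E e s = bval E e' s'}"

definition subst2 ::
  "('v, 'i, 'p) lang \<Rightarrow> 'v \<Rightarrow> 'i \<Rightarrow> 'v \<Rightarrow> 'i \<Rightarrow> 'v rel_on_stores \<Rightarrow> 'v rel_on_stores" where
  "subst2 E x e x' e' R = {(s, s'). (s(x := ival E e s), s'(x' := ival E e' s')) \<in> R}"

definition subst_left :: "('v, 'i, 'p) lang \<Rightarrow> 'v \<Rightarrow> 'i \<Rightarrow> 'v rel_on_stores \<Rightarrow> 'v rel_on_stores" where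
  "subst_left E x e R = {(s, s'). (s(x := ival E e s), s') \<in> R}"

definition subst_right :: "('v, 'i, 'p) lang \<Rightarrow> 'v \<Rightarrow> 'i \<Rightarrow> 'v rel_on_stores \<Rightarrow> 'v rel_on_stores" where
  "subst_right E x e R = {(s, s'). (s, s'(x := ival E e s')) \<in> R}"

definition indep :: "'v \<Rightarrow> 'v \<Rightarrow> 'v rel_on_stores \<Rightarrow> bool" where
  "indep x x' R \<longleftrightarrow> (\<forall>s s' v v'. (s(x := v), s'(x' := v')) \<in> R \<longleftrightarrow> (s, s') \<in> R)"

primrec ghost :: "('v, 'i, 'p) lang \<Rightarrow> 'v \<Rightarrow> ('v, 'i, 'p) com \<Rightarrow> bool"
  and ghost_gcs :: "('v, 'i, 'p) lang \<Rightarrow> 'v \<Rightarrow> ('v, 'i, 'p) gcs \<Rightarrow> bool" where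
  "ghost E x (Skip n) = True"
| "ghost E x (Asgn n y e) = (y = x \<or> x \<notin> ivars E e)"
| "ghost E x (Seq c d) = (ghost E x c \<and> ghost E x d)"
| "ghost E x (If n g) = ghost_gcs E x g"
| "ghost E x (Do n g) = ghost_gcs E x g"
| "ghost_gcs E x (GOne e c) = (x \<notin> bvars E e \<and> ghost E x c)"
| "ghost_gcs E x (GCons e c g) = (x \<notin> bvars E e \<and> ghost E x c \<and> ghost_gcs E x g)"

primrec erase :: "'v \<Rightarrow> ('v, 'i, 'p) com \<Rightarrow> ('v, 'i, 'p) com"
  and erase_gcs :: "'v \<Rightarrow> ('v, 'i, 'p) gcs \<Rightarrow> ('v, 'i, 'p) gcs" where
  "erase x (Skip n) = Skip n"
| "erase x (Asgn n y e) = (if y = x then Skip n else Asgn n y e)"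
| "erase x (Seq c d) = Seq (erase x c) (erase x d)"
| "erase x (If n g) = If n (erase_gcs x g)"
| "erase x (Do n g) = Do n (erase_gcs x g)"
| "erase_gcs x (GOne e c) = GOne e (erase x c)"
| "erase_gcs x (GCons e c g) = GCons e (erase x c) (erase_gcs x g)"

text \<open>
  \<open>rhl E c c' R S\<close>: the judgment \<open>c | c' : \<langle>R\<rangle>\<langle>S\<rangle>\<close> is derivable. Labels play no role in the
  rules, so they are arbitrary wherever a rule mentions a command constructor. Assertions are
  represented semantically: conjunction, disjunction, negation and entailment are intersection,
  union, complement and inclusion.
\<close>

inductive rhl :: "('v, 'i, 'p) lang \<Rightarrow> ('v, 'i, 'p) com \<Rightarrow> ('v, 'i, 'p) com \<Rightarrow>
    'v rel_on_stores \<Rightarrow> 'v rel_on_stores \<Rightarrow> bool"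
  for E where
  rRewrite: "\<lbrakk>rhl E c c' R S; com_equiv E c d; com_equiv E c' d'\<rbrakk> \<Longrightarrow> rhl E d d' R S"
| rGhost: "\<lbrakk>rhl E c c' R S; ghost E x c; ghost E x' c'; indep x x' R; indep x x' S\<rbrakk> \<Longrightarrow>
    rhl E (erase x c) (erase x' c') R S"
| dIf: "(\<And>e c e' c'. (e, c) \<in> guarded g \<Longrightarrow> (e', c') \<in> guarded g' \<Longrightarrow>
      rhl E c c' (R \<inter> on_left E e \<inter> on_right E e') S) \<Longrightarrow>
    rhl E (If n g) (If n' g') R S"
| dAsgn: "rhl E (Asgn n x e) (Asgn n' x' e') (subst2 E x e x' e' R) R"
| AsgnSkip: "rhl E (Asgn n x e) (Skip n') (subst_left E x e R) R"
| SkipAsgn: "rhl E (Skip n) (Asgn n' x e) (subst_right E x e R) R"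
| dSkip: "rhl E (Skip n) (Skip n') R R"
| dSeq: "\<lbrakk>rhl E c c' R S; rhl E d d' S T\<rbrakk> \<Longrightarrow> rhl E (Seq c d) (Seq c' d') R T"
| dDo: "\<lbrakk>\<And>e c. (e, c) \<in> guarded g \<Longrightarrow>
      rhl E c (Skip k) (Q \<inter> on_left E e \<inter> \<Lambda>) Q;
    \<And>e' c'. (e', c') \<in> guarded g' \<Longrightarrow>
      rhl E (Skip k') c' (Q \<inter> on_right E e' \<inter> P) Q;
    \<And>e c e' c'. (e, c) \<in> guarded g \<Longrightarrow> (e', c') \<in> guarded g' \<Longrightarrow>
      rhl E c c' (Q \<inter> on_left E e \<inter> on_right E e' \<inter> - \<Lambda> \<inter> - P) Q;
    Q \<subseteq> agree E (enab g) (enab g') \<union> (\<Lambda> \<inter> on_left E (enab g)) \<union> (P \<inter> on_right E (enab g'))\<rbrakk> \<Longrightarrow>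
    rhl E (Do n g) (Do n' g') Q (Q \<inter> - on_left E (enab g) \<inter> - on_right E (enab g'))"
| rConseq: "\<lbrakk>P \<subseteq> R; rhl E c d R S; S \<subseteq> Q\<rbrakk> \<Longrightarrow> rhl E c d P Q"
| rDisj: "\<lbrakk>rhl E c d Q S; rhl E c d R S\<rbrakk> \<Longrightarrow> rhl E c d (Q \<union> R) S"
| rFalse: "rhl E c d {} R"

end

(*
  A valid annotation of the alignment automaton makes the judgment c | c' semantically valid: a pair
  of terminating runs of the two automata can be interleaved as L, R and J prescribe, and liveness
  ensures that the side that must move has not yet finished. Conversely, every semantically valid
  judgment is derivable without ghost variables, since assertions are arbitrary relations: rewrite
  c | c' to c; skip | skip; c' and prove the halves with the strongest postcondition of c in the
  middle. In c | skip the trivial side is rewritten so as to match the shape of c, namely to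
  if p or not p -> skip fi or to do p and not p -> skip od.
*)
theory Submission
  imports Defs
begin

section \<open>Big-step semantics and runs of automata\<close>

text \<open>The denotation of commands as an inductive predicate, so that loops are treated by rule
  induction instead of by a separate induction over a closure.\<close>

inductive exec :: "('v, 'i, 'p) lang \<Rightarrow> ('v, 'i, 'p) com \<Rightarrow> 'v store \<Rightarrow> 'v store \<Rightarrow> bool"
  for E where
  Skip: "exec E (Skip n) s s"
| Asgn: "exec E (Asgn n x e) s (s(x := ival E e s))"
| Seq: "\<lbrakk>exec E c s u; exec E d u t\<rbrakk> \<Longrightarrow> exec E (Seq c d) s t"
| If: "\<lbrakk>(e, d) \<in> guarded g; bval E e s; exec E d s t\<rbrakk> \<Longrightarrow> exec E (If n g) s t"
| DoIter: "\<lbrakk>(e, d) \<in> guarded g; bval E e s; exec E d s u; exec E (Do n g) u t\<rbrakk> \<Longrightarrow>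
    exec E (Do n g) s t"
| DoExit: "\<not> bval E (enab g) s \<Longrightarrow> exec E (Do n g) s s"

lemma distinct_body: "(e, d) \<in> guarded g \<Longrightarrow> distinct (lablist_gcs g) \<Longrightarrow> distinct (lablist d)"
  by (induction g rule: gcs.induct[where ?P1.0 = "\<lambda>_. True"]) auto

text \<open>\<open>sub_gcs\<close> and \<open>fsuc_gcs\<close> descend into the first body whose
  labels include \<open>n\<close>. Distinctness of labels means that no earlier body can capture a
  label of \<open>d\<close>.\<close>

lemma sub_fsuc_body:
  assumes "(e, d) \<in> guarded g" "distinct (lablist_gcs g)" "n \<in> labs d"
  shows "sub_gcs n g = sub n d \<and> fsuc_gcs n g f = fsuc n d f"
  using assms
proof (induction g rule: gcs.induct[where ?P1.0 = "\<lambda>_. True"])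
  case (GCons e' d' g)
  show ?case
  proof (cases "(e, d) \<in> guarded g")
    case True
    then have "n \<notin> labs d'"
      using GCons.prems body_labs[OF True] by (auto simp: labs_def)
    then show ?thesis using True GCons by simp
  qed (use GCons.prems in auto)
qed auto

text \<open>The transitions at \<open>n\<close> depend on the command only through its subcommand at
  \<open>n\<close> and the following successor. Hence the automaton of a part embeds in that of the
  whole once \<open>h\<close> is the label at which the whole continues after
  \<open>d\<close>.\<close>

lemma aut_trans_mono:
  assumes "\<And>n. n \<in> labs d \<Longrightarrow> sub n c = sub n d \<and> fsuc n c f = fsuc n d h"
  shows "aut_trans E d h p q \<Longrightarrow> aut_trans E c f p q"
proof -
  assume tr: "aut_trans E d h p q"
  obtain n s m t where [simp]: "p = (n, s)" "q = (m, t)" by fastforce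
  have "n \<in> labs d" using tr by (auto simp: aut_trans_def sub_labs)
  then show ?thesis using tr assms[of n] by (simp add: aut_trans_def)
qed

lemma aut_runs_mono:
  assumes "(aut_trans E d h)\<^sup>*\<^sup>* p q"
    and "\<And>n. n \<in> labs d \<Longrightarrow> sub n c = sub n d \<and> fsuc n c f = fsuc n d h"
  shows "(aut_trans E c f)\<^sup>*\<^sup>* p q"
  using assms(1) by (rule mono_rtranclp[rule_format, rotated]) (rule aut_trans_mono[OF assms(2)])

text \<open>The label \<open>f\<close> must vary in the induction: the first component of a sequence
  continues at the label of the second, and a loop body continues at the loop itself.\<close>

lemma exec_aut_run:
  assumes "exec E c s t" "ok c"
  shows "(aut_trans E c f)\<^sup>*\<^sup>* (lab c, s) (f, t)"
  using assms
proof (induction arbitrary: f)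
  case (Skip n s)
  then show ?case by (auto simp: aut_trans_def)
next
  case (Asgn n x e s)
  then have "aut_trans E (Asgn n x e) f (n, s) (f, s(x := ival E e s))"
    using step.Asgn[of E n x e s] by (force simp: aut_trans_def ok_def labs_def)
  then show ?case unfolding lab.simps by (rule r_into_rtranclp)
next
  case (Seq c s u d t)
  have ok: "ok c" "ok d" "labs c \<inter> labs d = {}"
    using Seq.prems by (auto simp: ok_def labs_def)
  have "(aut_trans E (Seq c d) f)\<^sup>*\<^sup>* (lab c, s) (lab d, u)"
    by (rule aut_runs_mono[OF Seq.IH(1)[OF ok(1)]]) simp
  moreover have "(aut_trans E (Seq c d) f)\<^sup>*\<^sup>* (lab d, u) (f, t)"
    by (rule aut_runs_mono[OF Seq.IH(2)[OF ok(2)]]) (use ok(3) in auto)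
  ultimately show ?case by simp
next
  case (If e d g s t n)
  have d: "distinct (lablist_gcs g)" "n \<notin> set (lablist_gcs g)" "labs d \<subseteq> set (lablist_gcs g)"
    and pos: "\<forall>m\<in>set (lablist_gcs g). m > 0"
    using If.prems body_labs[OF If.hyps(1)] by (auto simp: ok_def labs_def)
  have okd: "ok d" using d pos distinct_body[OF If.hyps(1)] by (auto simp: ok_def)
  have "aut_trans E (If n g) f (n, s) (lab d, s)"
    using step.If[OF If.hyps(1,2)] okd lab_in_labs[of d] by (auto simp: aut_trans_def ok_def)
  moreover have "(aut_trans E (If n g) f)\<^sup>*\<^sup>* (lab d, s) (f, t)"
    by (rule aut_runs_mono[OF If.IH[OF okd]]) (use d sub_fsuc_body[OF If.hyps(1) d(1)] in auto)
  ultimately show ?case by simp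
next
  case (DoIter e d g s u n t)
  have d: "distinct (lablist_gcs g)" "n \<notin> set (lablist_gcs g)" "labs d \<subseteq> set (lablist_gcs g)"
    and pos: "\<forall>m\<in>set (lablist_gcs g). m > 0"
    using DoIter.prems body_labs[OF DoIter.hyps(1)] by (auto simp: ok_def labs_def)
  have okd: "ok d" using d pos distinct_body[OF DoIter.hyps(1)] by (auto simp: ok_def)
  \<comment> \<open>The step leads to \<open>d\<close> followed by the loop, and the label of a
    sequence is that of its first component.\<close>
  have "aut_trans E (Do n g) f (n, s) (lab d, s)"
    using step.DoIter[OF DoIter.hyps(1,2)] okd lab_in_labs[of d]
    by (force simp: aut_trans_def ok_def)
  moreover have "(aut_trans E (Do n g) f)\<^sup>*\<^sup>* (lab d, s) (n, u)"
    by (rule aut_runs_mono[OF DoIter.IH(1)[OF okd]])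
      (use d sub_fsuc_body[OF DoIter.hyps(1) d(1)] in auto)
  ultimately show ?case using DoIter.IH(2)[OF DoIter.prems, of f] by simp
next
  case (DoExit g s n)
  then have "aut_trans E (Do n g) f (n, s) (f, s)"
    using step.DoExit[OF DoExit.hyps, of n] by (force simp: aut_trans_def ok_def labs_def)
  then show ?case by auto
qed


section \<open>Soundness of valid annotations\<close>

text \<open>Induction on the total length of the two runs, because an aligned step may shorten the
  left run, the right run or both.\<close>

lemma annotation_sound:
  assumes aut: "is_automaton A" "is_automaton A'"
    and live: "live A A' L R J"
    and valid: "valid_annotation (align A A' L R J) an"
    and cover: "\<And>i j. (i, j) \<in> ctrl (align A A' L R J) \<Longrightarrow>
      lift_annotation (align A A' L R J) an (i, j) \<subseteq> L \<union> R \<union> J \<union> at_ctrl (fin A) (fin A')"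
    and runs: "(trans A ^^ k) (n, s) (fin A, t)" "(trans A' ^^ k') (n', s') (fin A', t')"
    and start: "n \<in> ctrl A" "n' \<in> ctrl A'" "(s, s') \<in> an (n, n')"
  shows "(t, t') \<in> an (fin A, fin A')"
  using runs start
proof (induction "k + k'" arbitrary: k k' n n' s s' rule: less_induct)
  case less
  have next_in: "(u, u') \<in> an (m, m')"
    if "align_trans A A' L R J ((n, n'), (s, s')) ((m, m'), (u, u'))" "m \<in> ctrl A" "m' \<in> ctrl A'"
    for m m' u u'
  proof -
    have "(n, n') \<in> ctrl (align A A' L R J)" "(m, m') \<in> ctrl (align A A' L R J)"
      "trans (align A A' L R J) ((n, n'), (s, s')) ((m, m'), (u, u'))"
      using less.prems that by (simp_all add: align_def)
    then show ?thesis using valid less.prems(5) unfolding valid_annotation_def by blast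
  qed
  \<comment> \<open>The transition supplied by liveness only shows that \<open>n\<close> is not
    final, so that the given run is nonempty. The step actually taken is the first one of that run,
    which may differ by nondeterminism.\<close>
  have left: "\<exists>j m u. k = Suc j \<and> m \<in> ctrl A \<and> trans A (n, s) (m, u) \<and>
      (trans A ^^ j) (m, u) (fin A, t)"
    if "\<exists>m u. trans A (n, s) (m, u)"
  proof -
    have "n \<noteq> fin A" using that aut(1) by (auto simp: is_automaton_def)
    then obtain j where j: "k = Suc j" using less.prems(1) by (cases k) auto
    then obtain m u where "trans A (n, s) (m, u)" "(trans A ^^ j) (m, u) (fin A, t)"
      using less.prems(1) relpowp_Suc_D2[of j "trans A" "(n, s)" "(fin A, t)"] by auto
    then show ?thesis using j aut(1) unfolding is_automaton_def by metis
  qed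
  have right: "\<exists>j m u. k' = Suc j \<and> m \<in> ctrl A' \<and> trans A' (n', s') (m, u) \<and>
      (trans A' ^^ j) (m, u) (fin A', t')"
    if "\<exists>m u. trans A' (n', s') (m, u)"
  proof -
    have "n' \<noteq> fin A'" using that aut(2) by (auto simp: is_automaton_def)
    then obtain j where j: "k' = Suc j" using less.prems(2) by (cases k') auto
    then obtain m u where "trans A' (n', s') (m, u)" "(trans A' ^^ j) (m, u) (fin A', t')"
      using less.prems(2) relpowp_Suc_D2[of j "trans A'" "(n', s')" "(fin A', t')"] by auto
    then show ?thesis using j aut(2) unfolding is_automaton_def by metis
  qed
  have "((n, n'), (s, s')) \<in> L \<union> R \<union> J \<union> at_ctrl (fin A) (fin A')"
    using cover[of n n'] less.prems by (auto simp: align_def lift_annotation_def)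
  then consider "((n, n'), (s, s')) \<in> L" | "((n, n'), (s, s')) \<in> R" | "((n, n'), (s, s')) \<in> J"
    | "n = fin A" "n' = fin A'"
    by (auto simp: at_ctrl_def)
  then show ?case
  proof cases
    case 1
    then obtain j m u where "k = Suc j" "m \<in> ctrl A" "trans A (n, s) (m, u)"
      "(trans A ^^ j) (m, u) (fin A, t)"
      using left live unfolding live_def by metis
    then show ?thesis
      using less.hyps[of j k' m u n' s'] less.prems next_in[of m n' u s'] 1
      by (auto simp: align_trans_def)
  next
    case 2
    then obtain j m u where "k' = Suc j" "m \<in> ctrl A'" "trans A' (n', s') (m, u)"
      "(trans A' ^^ j) (m, u) (fin A', t')"
      using right live unfolding live_def by metis
    then show ?thesis
      using less.hyps[of k j n s m u] less.prems next_in[of n m s u] 2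
      by (auto simp: align_trans_def)
  next
    case 3
    then obtain j m u where l: "k = Suc j" "m \<in> ctrl A" "trans A (n, s) (m, u)"
      "(trans A ^^ j) (m, u) (fin A, t)"
      using left live unfolding live_def by metis
    obtain j' m' u' where "k' = Suc j'" "m' \<in> ctrl A'" "trans A' (n', s') (m', u')"
      "(trans A' ^^ j') (m', u') (fin A', t')"
      using 3 right live unfolding live_def by metis
    then show ?thesis
      using less.hyps[of j j' m u m' u'] l next_in[of m m' u u'] 3
      by (auto simp: align_trans_def)
  next
    case 4
    \<comment> \<open>No transition leaves a final control point, so both runs are empty
      here.\<close>
    then have "k = 0" using less.prems(1) aut(1) relpowp_Suc_D2[of _ "trans A" "(n, s)"]
      by (cases k) (force simp: is_automaton_def)+
    moreover have "k' = 0" using 4 less.prems(2) aut(2) relpowp_Suc_D2[of _ "trans A'" "(n', s')"]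
      by (cases k') (force simp: is_automaton_def)+
    ultimately show ?thesis using 4 less.prems by auto
  qed
qed


section \<open>Completeness of RHL+ by sequential composition\<close>

lemma com_equiv_refl: "com_equiv E c c"
  by (simp add: com_equiv_def kat_eq.Refl)

lemma com_equiv_seq_skip: "com_equiv E (Seq c (Skip n)) c"
  by (simp add: com_equiv_def kat_eq.SeqOneR)

lemma com_equiv_skip_seq: "com_equiv E (Seq (Skip n) c) c"
  by (simp add: com_equiv_def kat_eq.SeqOneL)

lemma kat_neg_zero: "kat_eq E (KTest (TNeg TZero)) KOne"
proof -
  note [trans] = kat_eq.Trans
  have "kat_eq E (KTest (TNeg TZero)) (KPlus (KTest (TNeg TZero)) KZero)"
    by (rule kat_eq.Sym) (rule kat_eq.PlusZero)
  also have "kat_eq E \<dots> (KPlus KZero (KTest (TNeg TZero)))"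
    by (rule kat_eq.PlusComm)
  also have "kat_eq E \<dots> (KTest (TPlus TZero (TNeg TZero)))"
    by (rule kat_eq.Sym) (rule kat_eq.EmbPlus)
  also have "kat_eq E \<dots> KOne"
    by (rule kat_eq.TestExcl)
  finally show ?thesis .
qed

lemma kat_star_zero: "kat_eq E (KStar KZero) KOne"
proof -
  note [trans] = kat_eq.Trans
  have "kat_eq E (KStar KZero) (KPlus KOne (KSeq KZero (KStar KZero)))"
    by (rule kat_eq.Sym) (rule kat_eq.StarUnfoldL)
  also have "kat_eq E \<dots> (KPlus KOne KZero)"
    by (intro kat_eq.PlusCong kat_eq.Refl kat_eq.SeqZeroL)
  also have "kat_eq E \<dots> KOne"
    by (rule kat_eq.PlusZero)
  finally show ?thesis .
qed

text \<open>Boolean expressions have no truth constants; \<open>b\<close> or not \<open>b\<close>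
  stands for true, and excluded middle turns its test into 1.\<close>

lemma com_equiv_if_true:
  "com_equiv E (If n (GOne (BOr b (BNot b)) (Skip m))) (Skip k)"
  unfolding com_equiv_def by simp (rule kat_eq.Trans[OF kat_eq.SeqOneR kat_eq.TestExcl])

text \<open>The contradictory guard is 0, so the loop translates to the star of 0 followed by the
  negation of 0, both of which equal 1.\<close>

lemma com_equiv_do_false:
  "com_equiv E (Do n (GOne (BAnd b (BNot b)) (Skip m))) (Skip k)"
proof -
  let ?p = "ktest_of b"
  have zero: "kat_eq E (KTest (TSeq ?p (TNeg ?p))) KZero"
    by (rule kat_eq.TestContr)
  have "kat_eq E (KStar (KSeq (KTest (TSeq ?p (TNeg ?p))) KOne)) KOne"
    by (rule kat_eq.Trans[OF kat_eq.StarCong[OF kat_eq.Trans[OF kat_eq.SeqOneR zero]] kat_star_zero])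
  moreover have "kat_eq E (KTest (TNeg (TSeq ?p (TNeg ?p)))) KOne"
    by (rule kat_eq.Trans[OF kat_eq.NegCong[OF zero] kat_neg_zero])
  ultimately show ?thesis
    unfolding com_equiv_def by simp (rule kat_eq.Trans[OF kat_eq.SeqCong kat_eq.SeqOneR])
qed

text \<open>Each rule is its own mirror image or, as with \<open>AsgnSkip\<close> and
  \<open>SkipAsgn\<close>, has a mirrored partner. Completeness thus needs proof only with skip on
  the right.\<close>

lemma rhl_converse: "rhl E c c' R S \<Longrightarrow> rhl E c' c (R\<inverse>) (S\<inverse>)"
proof (induction rule: rhl.induct)
  case (rRewrite c c' R S d d')
  then show ?case by (blast intro: rhl.rRewrite)
next
  case (rGhost c c' R S x x')
  have "indep x' x (R\<inverse>)" "indep x' x (S\<inverse>)"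
    using rGhost.hyps by (auto simp: indep_def)
  then show ?case using rGhost by (blast intro: rhl.rGhost)
next
  case (dIf g g' R S n n')
  have "(R \<inter> on_left E e \<inter> on_right E e')\<inverse> = R\<inverse> \<inter> on_left E e' \<inter> on_right E e" for e e'
    by (auto simp: on_left_def on_right_def)
  then show ?case using dIf.IH by (metis rhl.dIf)
next
  case (dAsgn n x e n' x' e' R)
  have "(subst2 E x e x' e' R)\<inverse> = subst2 E x' e' x e (R\<inverse>)" by (auto simp: subst2_def)
  then show ?case by (metis rhl.dAsgn)
next
  case (AsgnSkip n x e n' R)
  have "(subst_left E x e R)\<inverse> = subst_right E x e (R\<inverse>)"
    by (auto simp: subst_left_def subst_right_def)
  then show ?case by (metis rhl.SkipAsgn)
next
  case (SkipAsgn n n' x e R)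
  have "(subst_right E x e R)\<inverse> = subst_left E x e (R\<inverse>)"
    by (auto simp: subst_left_def subst_right_def)
  then show ?case by (metis rhl.AsgnSkip)
next
  case (dSkip n n' R)
  then show ?case by (rule rhl.dSkip)
next
  case (dSeq c c' R S d d' T)
  then show ?case by (blast intro: rhl.dSeq)
next
  case (dDo g k Q \<Lambda> g' k' P n n')
  have eqs: "(Q \<inter> on_left E e \<inter> X)\<inverse> = Q\<inverse> \<inter> on_right E e \<inter> X\<inverse>"
    "(Q \<inter> on_right E e \<inter> X)\<inverse> = Q\<inverse> \<inter> on_left E e \<inter> X\<inverse>"
    "(Q \<inter> on_left E e \<inter> on_right E e' \<inter> - \<Lambda> \<inter> - P)\<inverse> =
      Q\<inverse> \<inter> on_left E e' \<inter> on_right E e \<inter> - P\<inverse> \<inter> - \<Lambda>\<inverse>"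
    "(Q \<inter> - on_left E e \<inter> - on_right E e')\<inverse> = Q\<inverse> \<inter> - on_left E e' \<inter> - on_right E e"
    for e e' X
    by (auto simp: on_left_def on_right_def)
  \<comment> \<open>The conditions for left-only and right-only iterations, \<Lambda> and
    \<open>P\<close>, exchange their roles.\<close>
  have "Q\<inverse> \<subseteq> agree E (enab g') (enab g) \<union> (P\<inverse> \<inter> on_left E (enab g')) \<union> (\<Lambda>\<inverse> \<inter> on_right E (enab g))"
    using dDo.hyps by (auto simp: agree_def on_left_def on_right_def)
  then show ?case
    unfolding eqs by (intro rhl.dDo) (use dDo.IH in \<open>simp_all add: eqs\<close>)
next
  case (rConseq P R c d S Q)
  then show ?case by (meson converse_mono rhl.rConseq)
next
  case (rDisj c d Q S R)
  then show ?case by (simp add: converse_Un rhl.rDisj)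
next
  case (rFalse c d R)
  then show ?case by (simp add: rhl.rFalse)
qed

lemma rhl_if_skip:
  assumes "\<And>e c. (e, c) \<in> guarded g \<Longrightarrow> rhl E c (Skip k) (R \<inter> on_left E e) S"
  shows "rhl E (If n g) (Skip k) R S"
proof -
  have "rhl E (If n g) (If k (GOne (BOr b (BNot b)) (Skip k))) R S" for b
    using assms by (intro rhl.dIf) (auto intro: rhl.rConseq)
  then show ?thesis
    by (rule rhl.rRewrite[OF _ com_equiv_refl com_equiv_if_true])
qed

lemma rhl_do_skip:
  fixes g :: "('v, 'i, 'p) gcs"
  assumes "\<And>e c. (e, c) \<in> guarded g \<Longrightarrow> rhl E c (Skip k) (Q \<inter> on_left E e) Q"
  shows "rhl E (Do n g) (Skip k) Q (Q \<inter> - on_left E (enab g))"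
proof -
  fix b :: "'p bexp"
  let ?g = "GOne (BAnd b (BNot b)) (Skip k) :: ('v, 'i, 'p) gcs"
  have "rhl E (Do n g) (Do k ?g) Q (Q \<inter> - on_left E (enab g) \<inter> - on_right E (enab ?g))"
    \<comment> \<open>Every iteration is left-only. The right-only and joint premises then have
      empty preconditions. The side condition holds since the left guard is either enabled or, like
      the right one, disabled.\<close>
    by (rule rhl.dDo[where \<Lambda> = UNIV and P = "{}" and k = k and k' = k])
      (use assms in \<open>auto simp: agree_def on_left_def intro: rhl.rFalse\<close>)
  then have "rhl E (Do n g) (Do k ?g) Q (Q \<inter> - on_left E (enab g))"
    by (rule rhl.rConseq[OF order_refl]) auto
  then show ?thesis
    by (rule rhl.rRewrite[OF _ com_equiv_refl com_equiv_do_false])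
qed

text \<open>Structural induction; the second claim passes the hypothesis to each body of a guarded
  command list. The relations vary because sequences and loops introduce intermediate
  assertions.\<close>

lemma rhl_skip_complete:
  fixes c :: "('v, 'i, 'p) com" and g :: "('v, 'i, 'p) gcs"
  shows "(\<And>s s' t. (s, s') \<in> R \<Longrightarrow> exec E c s t \<Longrightarrow> (t, s') \<in> S) \<Longrightarrow> rhl E c (Skip k) R S"
    and "(e, d) \<in> guarded g \<Longrightarrow> (\<And>s s' t. (s, s') \<in> R \<Longrightarrow> exec E d s t \<Longrightarrow> (t, s') \<in> S) \<Longrightarrow>
      rhl E d (Skip k) R S"
proof (induction c and g arbitrary: R S and e d R S)
  case (Skip n)
  have "R \<subseteq> S" using Skip exec.Skip by fastforce
  then show ?case by (blast intro: rhl.rConseq rhl.dSkip)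
next
  case (Asgn n x e)
  have "R \<subseteq> subst_left E x e S" using Asgn exec.Asgn by (fastforce simp: subst_left_def)
  then show ?case by (blast intro: rhl.rConseq rhl.AsgnSkip)
next
  case (Seq c d)
  let ?M = "{(u, s'). \<exists>s. (s, s') \<in> R \<and> exec E c s u}"
  have "rhl E c (Skip k) R ?M" by (rule Seq.IH(1)) auto
  moreover have "rhl E d (Skip k) ?M S"
    by (rule Seq.IH(2)) (use Seq.prems in \<open>auto intro: exec.Seq\<close>)
  ultimately show ?case
    \<comment> \<open>\<open>dSeq\<close> leaves skip followed by skip on the right, which collapses
      to skip.\<close>
    by (rule rhl.rRewrite[OF rhl.dSeq com_equiv_refl com_equiv_seq_skip])
next
  case (If n g)
  show ?case
  proof (rule rhl_if_skip)
    fix e c assume "(e, c) \<in> guarded g"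
    then show "rhl E c (Skip k) (R \<inter> on_left E e) S"
      using If.prems by (intro If.IH) (auto simp: on_left_def intro: exec.If)
  qed
next
  case (Do n g)
  \<comment> \<open>the weakest loop invariant that entails the postcondition\<close>
  let ?Q = "{(s, s'). \<forall>t. exec E (Do n g) s t \<longrightarrow> (t, s') \<in> S}"
  have "rhl E (Do n g) (Skip k) ?Q (?Q \<inter> - on_left E (enab g))"
  proof (rule rhl_do_skip)
    fix e c assume "(e, c) \<in> guarded g"
    then show "rhl E c (Skip k) (?Q \<inter> on_left E e) ?Q"
      by (intro Do.IH) (auto simp: on_left_def intro: exec.DoIter)
  qed
  then show ?case
    by (rule rhl.rConseq[rotated]) (use Do.prems in \<open>auto simp: on_left_def intro: exec.DoExit\<close>)
next
  case (GOne e c)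
  then show ?case by auto
next
  case (GCons e c g)
  then show ?case by (metis Pair_inject guarded.simps(2) insertE)
qed

lemma rhl_complete:
  assumes "\<And>s s' t t'. (s, s') \<in> R \<Longrightarrow> exec E c s t \<Longrightarrow> exec E c' s' t' \<Longrightarrow> (t, t') \<in> S"
  shows "rhl E c c' R S"
proof -
  let ?M = "{(t, s'). \<exists>s. (s, s') \<in> R \<and> exec E c s t}"
  have "rhl E c (Skip 0) R ?M" by (rule rhl_skip_complete(1)) auto
  \<comment> \<open>The half with skip on the left is obtained by proving its converse.\<close>
  moreover have "rhl E c' (Skip 0) (?M\<inverse>) (S\<inverse>)"
    by (rule rhl_skip_complete(1)) (use assms in auto)
  then have "rhl E (Skip 0) c' ?M S" using rhl_converse by fastforce
  ultimately show ?thesis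
    by (rule rhl.rRewrite[OF rhl.dSeq com_equiv_seq_skip com_equiv_skip_seq])
qed

theorem theorem7p1:
  fixes E :: "('v, 'i, 'p) lang"
    and c c' :: "('v, 'i, 'p) com"
    and f f' :: int
    and A A' :: "(int, 'v store) automaton"
    and L R J :: "(int, int, 'v store, 'v store) conds"
    and S T :: "'v rel_on_stores"
    and an :: "int \<times> int \<Rightarrow> 'v rel_on_stores"
  assumes "expr_lang E"
    and "wf_com E c" and "wf_com E c'"
    and "okf c f" and "okf c' f'"
    and "A = aut E c f" and "A' = aut E c' f'"
    and "L \<subseteq> (ctrl A \<times> ctrl A') \<times> UNIV"
    and "R \<subseteq> (ctrl A \<times> ctrl A') \<times> UNIV"
    and "J \<subseteq> (ctrl A \<times> ctrl A') \<times> UNIV"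
    and "live A A' L R J"
    and "annotation (align A A' L R J) S T an"
    and "valid_annotation (align A A' L R J) an"
    and "\<And>i j. (i, j) \<in> ctrl (align A A' L R J) \<Longrightarrow>
           lift_annotation (align A A' L R J) an (i, j) \<subseteq> L \<union> R \<union> J \<union> at_ctrl f f'"
  shows "rhl E c c' S T"
proof (rule rhl_complete)
  fix s s' t t' assume st: "(s, s') \<in> S" and ex: "exec E c s t" "exec E c' s' t'"
  have aut: "is_automaton A" "is_automaton A'"
    using assms(4-7) by (simp_all add: aut_is_automaton)
  have "(trans A)\<^sup>*\<^sup>* (init A, s) (fin A, t)" "(trans A')\<^sup>*\<^sup>* (init A', s') (fin A', t')"
    using assms(4-7) exec_aut_run ex by (auto simp: aut_def okf_def)
  \<comment> \<open>The lengths of the runs are made explicit, since \<open>annotation_sound\<close>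
    inducts on them.\<close>
  then obtain k k' where "(trans A ^^ k) (init A, s) (fin A, t)"
    "(trans A' ^^ k') (init A', s') (fin A', t')"
    by (auto dest!: rtranclp_imp_relpowp)
  moreover have "init A \<in> ctrl A" "init A' \<in> ctrl A'"
    using aut by (simp_all add: is_automaton_def)
  moreover have "an (init A, init A') = S" "an (fin A, fin A') = T"
    using assms(12) by (simp_all add: annotation_def align_def)
  moreover have "fin A = f" "fin A' = f'" using assms(6,7) by (simp_all add: aut_def)
  ultimately show "(t, t') \<in> T"
    using annotation_sound[OF aut assms(11,13), of k "init A" s t k' "init A'" s' t'] assms(14) st
    by simp
qed

end
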